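(* Let $X$ be a set and let $Y$ be an infinite subset of $X$. Then $K(\overline{\Omega}(X,Y))=J(0,0)$; that is, the kernel (the unique minimal ideal) of $\overline{\Omega}(X,Y)$ exists and equals $J(0,0)$.
   Context: $T(X)$ is the semigroup of all maps $X\to X$ under composition; maps are written on the right and composed from left to right, so $x(fg)=(xf)g$, and for $B\subseteq X$, $Bf=\{xf\colon x\in B\}$. Let $\overline{\Omega}(X,Y)=\{f\in T(X)\colon Yf=Y\}$, a subsemigroup of $T(X)$. For $f\in\overline{\Omega}(X,Y)$, $f_{\upharpoonright Y}\colon Y\to Y$ denotes the (surjective) map that agrees with $f$ on $Y$. For an infinite set $A$ and a surjective map $\alpha\colon A\to A$, let $N(\alpha)=\{a\in A\colon |a\alpha^{-1}|<|A|\}$, where $a\alpha^{-1}=\{z\in A\colon z\alpha=a\}$, and let $n(\alpha)=|N(\alpha)|$. For cardinal numbers $s,t$ with $0\leq s\leq|Y|$ and $0\leq t\leq|X\setminus Y|$, let $J(s,t)=\{f\in\overline{\Omega}(X,Y)\colon n(f_{\upharpoonright Y})\leq s \text{ and } |Xf\setminus Y|\leq t\}$. An ideal of a semigroup $S$ is a nonempty subset $I\subseteq S$ with $SI\subseteq I$ and $IS\subseteq I$; it is minimal if no ideal of $S$ is strictly contained in it. A semigroup has at most one minimal ideal; if it exists, it is called the kernel of $S$ and denoted $K(S)$. *)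

theory Defs
  imports "HOL-Algebra.Coset"
begin

unbundle cardinal_syntax

text \<open>
  Maps on a set \<open>X\<close> are the extensional functions \<open>X \<rightarrow>\<^sub>E X\<close>, so that equality of functions
  is equality of maps on \<open>X\<close>. Maps act on the right: the product \<open>f \<otimes> g\<close> is ``first \<open>f\<close>,
  then \<open>g\<close>''.
\<close>

definition full_transf :: "'a set \<Rightarrow> ('a \<Rightarrow> 'a) monoid"
  where "full_transf X =
    \<lparr>carrier = X \<rightarrow>\<^sub>E X, mult = (\<lambda>f g. compose X g f), one = (\<lambda>x\<in>X. x)\<rparr>"

definition Omega_bar :: "'a set \<Rightarrow> 'a set \<Rightarrow> ('a \<Rightarrow> 'a) monoid"
  where "Omega_bar X Y =
    (full_transf X)\<lparr>carrier := {f \<in> carrier (full_transf X). f ` Y = Y}\<rparr>"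

lemma monoid_full_transf: "monoid (full_transf X)"
proof (rule monoidI)
  fix f g h
  assume "f \<in> carrier (full_transf X)"
  then show "f \<otimes>\<^bsub>full_transf X\<^esub> g \<otimes>\<^bsub>full_transf X\<^esub> h =
      f \<otimes>\<^bsub>full_transf X\<^esub> (g \<otimes>\<^bsub>full_transf X\<^esub> h)"
    by (auto simp: full_transf_def compose_def fun_eq_iff)
qed (auto simp: full_transf_def compose_def PiE_iff extensional_def fun_eq_iff)

lemma submonoid_Omega_bar:
  assumes "Y \<subseteq> X"
  shows "submonoid (carrier (Omega_bar X Y)) (full_transf X)"
proof
  fix f g
  assume *: "f \<in> carrier (Omega_bar X Y)" "g \<in> carrier (Omega_bar X Y)"
  then have "compose X g f ` Y = g ` (f ` Y)"
    using assms by (force simp: compose_def)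
  then show "f \<otimes>\<^bsub>full_transf X\<^esub> g \<in> carrier (Omega_bar X Y)"
    using * by (auto simp: Omega_bar_def full_transf_def compose_def)
next
  have "(\<lambda>x\<in>X. x) ` Y = Y"
    using assms by force
  then show "\<one>\<^bsub>full_transf X\<^esub> \<in> carrier (Omega_bar X Y)"
    by (auto simp: Omega_bar_def full_transf_def)
qed (auto simp: Omega_bar_def)

text \<open>The identity element of the record plays no role in the notions below.\<close>

definition semigroup_ideal :: "('a, 'm) monoid_scheme \<Rightarrow> 'a set \<Rightarrow> bool"
  where "semigroup_ideal S I \<longleftrightarrow>
    I \<noteq> {} \<and> I \<subseteq> carrier S \<and> carrier S <#>\<^bsub>S\<^esub> I \<subseteq> I \<and> I <#>\<^bsub>S\<^esub> carrier S \<subseteq> I"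

definition minimal_ideal :: "('a, 'm) monoid_scheme \<Rightarrow> 'a set \<Rightarrow> bool"
  where "minimal_ideal S I \<longleftrightarrow>
    semigroup_ideal S I \<and> \<not> (\<exists>I'. semigroup_ideal S I' \<and> I' \<subset> I)"

text \<open>Meaningful only when a (necessarily unique) minimal ideal exists.\<close>

definition semigroup_kernel :: "('a, 'm) monoid_scheme \<Rightarrow> 'a set"
  where "semigroup_kernel S = (THE I. minimal_ideal S I)"

definition small_fibre_points :: "'a set \<Rightarrow> ('a \<Rightarrow> 'a) \<Rightarrow> 'a set"
  where "small_fibre_points A \<alpha> = {a \<in> A. |{z \<in> A. \<alpha> z = a}| <o |A|}"

definition small_fibre_card :: "'a set \<Rightarrow> ('a \<Rightarrow> 'a) \<Rightarrow> 'a rel"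
  where "small_fibre_card A \<alpha> = |small_fibre_points A \<alpha>|"

text \<open>
  The cardinals \<open>s \<le> |Y|\<close> and \<open>t \<le> |X - Y|\<close> are given as cardinal orders; since only
  \<open>\<le>o\<close> is used, the choice of representatives does not matter.
\<close>

definition J_set :: "'a set \<Rightarrow> 'a set \<Rightarrow> 's rel \<Rightarrow> 't rel \<Rightarrow> ('a \<Rightarrow> 'a) set"
  where "J_set X Y s t = {f \<in> carrier (Omega_bar X Y).
    small_fibre_card Y (restrict f Y) \<le>o s \<and> |f ` X - Y| \<le>o t}"

end

theory Submission
  imports Defs
begin

text \<open>
  The set \<open>J(0,0)\<close> consists of the maps of \<open>X\<close> into \<open>Y\<close> all of whose fibres, cut down to \<open>Y\<close>,
  have the full size \<open>|Y|\<close> (lemma \<open>mem_J_zero_iff\<close>). When such a map is multiplied, on either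
  side, by a map that takes \<open>Y\<close> onto \<open>Y\<close>, each fibre of the product is at least as large as some
  fibre of the original. So \<open>J(0,0)\<close> is an ideal as soon as it is nonempty, and it is nonempty
  because \<open>|Y \<times> Y| = |Y|\<close>: the second projection \<open>Y \<times> Y \<rightarrow> Y\<close> has all its fibres of size \<open>|Y|\<close>.

  The decisive point is \<open>J_zero_left_divisible\<close>: if \<open>p\<close> and \<open>h\<close> are in \<open>J(0,0)\<close>, then
  \<open>h = g \<otimes> p\<close> for some \<open>g\<close> in the semigroup, because corresponding fibres of \<open>h\<close> and \<open>p\<close> in \<open>Y\<close>
  have the same size and so can be matched bijectively by \<open>g\<close>. An arbitrary ideal \<open>I\<close> meets
  \<open>J(0,0)\<close>, in the product of an element of \<open>J(0,0)\<close> and an element of \<open>I\<close>; hence it contains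
  all of \<open>J(0,0)\<close>. An ideal that lies in every ideal is the unique minimal one.
\<close>

lemma least_ideal_is_kernel:
  assumes K: "semigroup_ideal S K" and least: "\<And>I. semigroup_ideal S I \<Longrightarrow> K \<subseteq> I"
  shows "(\<exists>!I. minimal_ideal S I) \<and> semigroup_kernel S = K"
proof -
  have eq: "minimal_ideal S I \<longleftrightarrow> I = K" for I
    unfolding minimal_ideal_def using K least by blast
  show ?thesis
    unfolding semigroup_kernel_def eq by simp
qed

lemma carrier_Omega_bar: "carrier (Omega_bar X Y) = {f \<in> X \<rightarrow>\<^sub>E X. f ` Y = Y}"
  by (simp add: Omega_bar_def full_transf_def)

lemma mult_Omega_bar: "f \<otimes>\<^bsub>Omega_bar X Y\<^esub> g = compose X g f"
  by (simp add: Omega_bar_def full_transf_def)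

lemma Omega_bar_closed:
  assumes "Y \<subseteq> X" "f \<in> carrier (Omega_bar X Y)" "g \<in> carrier (Omega_bar X Y)"
  shows "f \<otimes>\<^bsub>Omega_bar X Y\<^esub> g \<in> carrier (Omega_bar X Y)"
  using submonoid.m_closed[OF submonoid_Omega_bar[OF assms(1)] assms(2,3)]
  by (simp add: Omega_bar_def)

lemma card_of_ordLeq_czero_iff: "|A| \<le>o (czero :: 'b rel) \<longleftrightarrow> A = {}"
  unfolding czero_def using card_of_empty3 card_of_empty by blast

lemma mem_J_zero_iff:
  "f \<in> J_set X Y (czero :: 's rel) (czero :: 't rel) \<longleftrightarrow>
    f \<in> carrier (Omega_bar X Y) \<and> f ` X \<subseteq> Y \<and> (\<forall>y\<in>Y. |Y| \<le>o |{z \<in> Y. f z = y}| )"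
proof -
  have fibre: "{z \<in> Y. restrict f Y z = y} = {z \<in> Y. f z = y}" for y
    by auto
  have large: "\<not> |{z \<in> Y. f z = y}| <o |Y| \<longleftrightarrow> |Y| \<le>o |{z \<in> Y. f z = y}|" for y
    by (rule not_ordLess_iff_ordLeq) (rule card_of_Well_order)+
  have "small_fibre_points Y (restrict f Y) = {} \<longleftrightarrow> (\<forall>y\<in>Y. |Y| \<le>o |{z \<in> Y. f z = y}| )"
    unfolding small_fibre_points_def fibre large[symmetric] by blast
  then show ?thesis
    by (simp add: J_set_def small_fibre_card_def card_of_ordLeq_czero_iff conj_commute)
qed

lemma J_zero_nonempty:
  assumes "Y \<subseteq> X" "infinite Y"
  shows "J_set X Y (czero :: 's rel) (czero :: 't rel) \<noteq> {}"
proof -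
  obtain b where b: "bij_betw b Y (Y \<times> Y)"
    using card_of_Times_same_infinite[OF assms(2)] card_of_ordIso ordIso_symmetric by blast
  obtain y0 where y0: "y0 \<in> Y"
    using assms(2) by (metis ex_in_conv finite.emptyI)
  define f where "f = (\<lambda>x\<in>X. if x \<in> Y then snd (b x) else y0)"
  have f_Y: "f x = snd (b x)" if "x \<in> Y" for x
    using that assms(1) by (auto simp: f_def)
  have bY: "b ` Y = Y \<times> Y"
    using b by (simp add: bij_betw_def)
  have "f ` Y = snd ` (b ` Y)"
    using f_Y by (simp add: image_image)
  then have fY: "f ` Y = Y"
    using bY y0 by simp
  have fX: "f ` X \<subseteq> Y"
    using bij_betw_apply[OF b] y0 by (auto simp: f_def mem_Times_iff)
  have "|Y| \<le>o |{z \<in> Y. f z = y}|" if "y \<in> Y" for y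
  proof (rule surj_imp_ordLeq)
    show "Y \<subseteq> (fst \<circ> b) ` {z \<in> Y. f z = y}"
    proof
      fix a assume "a \<in> Y"
      then have "(a, y) \<in> b ` Y"
        using bY that by simp
      then obtain z where "z \<in> Y" "b z = (a, y)"
        by (metis imageE)
      then show "a \<in> (fst \<circ> b) ` {z \<in> Y. f z = y}"
        using f_Y by force
    qed
  qed
  moreover have "f \<in> X \<rightarrow>\<^sub>E X"
  proof (rule PiE_I)
    show "f x \<in> X" if "x \<in> X" for x
      using that fX assms(1) by blast
  qed (simp add: f_def)
  ultimately have "f \<in> J_set X Y (czero :: 's rel) (czero :: 't rel)"
    using fX fY by (simp add: mem_J_zero_iff carrier_Omega_bar)
  then show ?thesis
    by blast
qed

text \<open>
  If \<open>y = g y'\<close> with \<open>y'\<close> in \<open>Y\<close>, then the fibre of \<open>f \<otimes> g\<close> over \<open>y\<close> contains the fibre of \<open>f\<close>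
  over \<open>y'\<close>.
\<close>

lemma J_zero_mult_right:
  assumes "Y \<subseteq> X" and f: "f \<in> J_set X Y (czero :: 's rel) (czero :: 't rel)"
    and g: "g \<in> carrier (Omega_bar X Y)"
  shows "f \<otimes>\<^bsub>Omega_bar X Y\<^esub> g \<in> J_set X Y (czero :: 's rel) (czero :: 't rel)"
proof -
  have f': "f \<in> carrier (Omega_bar X Y)" "f ` X \<subseteq> Y"
      "\<And>y. y \<in> Y \<Longrightarrow> |Y| \<le>o |{z \<in> Y. f z = y}|"
    using f by (auto simp: mem_J_zero_iff)
  have gY: "g ` Y = Y"
    using g by (simp add: carrier_Omega_bar)
  have "|Y| \<le>o |{z \<in> Y. compose X g f z = y}|" if y: "y \<in> Y" for y
  proof -
    obtain y' where y': "y' \<in> Y" "g y' = y"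
      using gY y by (metis imageE)
    have sub: "{z \<in> Y. f z = y'} \<subseteq> {z \<in> Y. compose X g f z = y}"
      using y' assms(1) by (auto simp: compose_def)
    show ?thesis
      by (rule ordLeq_transitive[OF f'(3)[OF y'(1)] card_of_mono1[OF sub]])
  qed
  moreover have "compose X g f ` X \<subseteq> Y"
    using f'(2) gY by (auto simp: compose_def)
  ultimately show ?thesis
    using Omega_bar_closed[OF assms(1) f'(1) g] by (simp add: mem_J_zero_iff mult_Omega_bar)
qed

text \<open>
  As \<open>g\<close> maps \<open>Y\<close> onto \<open>Y\<close>, it maps the fibre of \<open>g \<otimes> f\<close> over \<open>y\<close> onto the fibre of \<open>f\<close> over \<open>y\<close>.
\<close>

lemma J_zero_mult_left:
  assumes "Y \<subseteq> X" and f: "f \<in> J_set X Y (czero :: 's rel) (czero :: 't rel)"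
    and g: "g \<in> carrier (Omega_bar X Y)"
  shows "g \<otimes>\<^bsub>Omega_bar X Y\<^esub> f \<in> J_set X Y (czero :: 's rel) (czero :: 't rel)"
proof -
  have f': "f \<in> carrier (Omega_bar X Y)" "f ` X \<subseteq> Y"
      "\<And>y. y \<in> Y \<Longrightarrow> |Y| \<le>o |{z \<in> Y. f z = y}|"
    using f by (auto simp: mem_J_zero_iff)
  have gX: "g \<in> X \<rightarrow>\<^sub>E X" and gY: "g ` Y = Y"
    using g by (auto simp: carrier_Omega_bar)
  have "|Y| \<le>o |{z \<in> Y. compose X f g z = y}|" if "y \<in> Y" for y
  proof -
    have sub: "{z \<in> Y. f z = y} \<subseteq> g ` {z \<in> Y. compose X f g z = y}"
    proof
      fix w assume w: "w \<in> {z \<in> Y. f z = y}"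
      then obtain z where "z \<in> Y" "g z = w"
        using gY by (metis (lifting) imageE mem_Collect_eq)
      then show "w \<in> g ` {z \<in> Y. compose X f g z = y}"
        using w assms(1) by (auto simp: compose_def)
    qed
    show ?thesis
      by (rule ordLeq_transitive[OF f'(3)[OF that] surj_imp_ordLeq[OF sub]])
  qed
  moreover have "compose X f g ` X \<subseteq> Y"
    using f'(2) gX by (auto simp: compose_def)
  ultimately show ?thesis
    using Omega_bar_closed[OF assms(1) g f'(1)] by (simp add: mem_J_zero_iff mult_Omega_bar)
qed

lemma J_zero_ideal:
  assumes "Y \<subseteq> X" "infinite Y"
  shows "semigroup_ideal (Omega_bar X Y) (J_set X Y (czero :: 's rel) (czero :: 't rel))"
  unfolding semigroup_ideal_def
proof (intro conjI)
  show "J_set X Y (czero :: 's rel) (czero :: 't rel) \<subseteq> carrier (Omega_bar X Y)"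
    by (auto simp: J_set_def)
qed (use J_zero_nonempty[OF assms] J_zero_mult_left[OF assms(1)] J_zero_mult_right[OF assms(1)]
    in \<open>unfold set_mult_def, blast+\<close>)

text \<open>
  Over each \<open>y\<close> in \<open>Y\<close> the fibres of \<open>h\<close> and \<open>p\<close> in \<open>Y\<close> both have size \<open>|Y|\<close>. Bijections between
  them fit together to a map of \<open>Y\<close> onto \<open>Y\<close>, and a point outside \<open>Y\<close> can be sent to any point
  of \<open>Y\<close> in the right fibre of \<open>p\<close>, since \<open>h\<close> takes it into \<open>Y = p ` Y\<close>.
\<close>

lemma J_zero_left_divisible:
  assumes "Y \<subseteq> X" and p: "p \<in> J_set X Y (czero :: 's rel) (czero :: 't rel)"
    and h: "h \<in> J_set X Y (czero :: 's rel) (czero :: 't rel)"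
  shows "\<exists>g \<in> carrier (Omega_bar X Y). h = g \<otimes>\<^bsub>Omega_bar X Y\<^esub> p"
proof -
  define F where "F q y = {z \<in> Y. q z = y}" for q :: "'a \<Rightarrow> 'a" and y
  have pY: "p ` Y = Y" and p_fib: "\<And>y. y \<in> Y \<Longrightarrow> |Y| \<le>o |F p y|"
    using p by (auto simp: mem_J_zero_iff carrier_Omega_bar F_def)
  have h_ext: "h \<in> extensional X" and hY: "h ` Y = Y" and hX: "h ` X \<subseteq> Y"
    and h_fib: "\<And>y. y \<in> Y \<Longrightarrow> |Y| \<le>o |F h y|"
    using h by (auto simp: mem_J_zero_iff carrier_Omega_bar F_def PiE_def)
  have "|F h y| =o |F p y|" if "y \<in> Y" for y
  proof -
    have le: "|F q y| \<le>o |Y|" for q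
      by (rule card_of_mono1) (auto simp: F_def)
    show ?thesis
      using ordLeq_transitive[OF le p_fib[OF that]] ordLeq_transitive[OF le h_fib[OF that]]
      by (simp add: ordIso_iff_ordLeq)
  qed
  then have "\<forall>y\<in>Y. \<exists>b. bij_betw b (F h y) (F p y)"
    using card_of_ordIso by blast
  then obtain b where "\<forall>y\<in>Y. bij_betw (b y) (F h y) (F p y)"
    by metis
  then have b: "b y ` F h y = F p y" if "y \<in> Y" for y
    using that by (simp add: bij_betw_def)
  have "\<forall>y\<in>Y. \<exists>z\<in>Y. p z = y"
    using pY by (metis imageE)
  then obtain c where c: "\<And>y. y \<in> Y \<Longrightarrow> c y \<in> Y \<and> p (c y) = y"
    by metis
  define g where "g = (\<lambda>x\<in>X. if x \<in> Y then b (h x) x else c (h x))"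
  have g_Y: "g x = b (h x) x" if "x \<in> Y" for x
    using that assms(1) by (auto simp: g_def)
  have g: "g x \<in> Y \<and> p (g x) = h x" if "x \<in> X" for x
  proof (cases "x \<in> Y")
    case True
    have "x \<in> F h (h x)" "h x \<in> Y"
      using True hY by (auto simp: F_def)
    then have "b (h x) x \<in> F p (h x)"
      using b by blast
    then show ?thesis
      using g_Y[OF True] by (simp add: F_def)
  next
    case False
    have "h x \<in> Y"
      using that hX by blast
    then show ?thesis
      using False that c by (simp add: g_def)
  qed
  have "Y \<subseteq> g ` Y"
  proof
    fix w assume "w \<in> Y"
    then have py: "p w \<in> Y" and "w \<in> F p (p w)"
      using pY by (auto simp: F_def)
    then have "w \<in> b (p w) ` F h (p w)"
      using b by simp
    then obtain z where "z \<in> Y" "h z = p w" "w = b (p w) z"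
      by (auto simp: F_def)
    then show "w \<in> g ` Y"
      using g_Y by (metis image_eqI)
  qed
  moreover have "g ` Y \<subseteq> Y"
    using g assms(1) by blast
  moreover have "g \<in> X \<rightarrow>\<^sub>E X"
    using g assms(1) by (auto simp: PiE_def Pi_def) (simp add: g_def)
  ultimately have "g \<in> carrier (Omega_bar X Y)"
    by (simp add: carrier_Omega_bar)
  moreover have "h = compose X p g"
    using g h_ext by (intro extensionalityI[of h X]) (auto simp: compose_def)
  ultimately show ?thesis
    by (auto simp: mult_Omega_bar)
qed

lemma J_zero_subset_ideal:
  assumes "Y \<subseteq> X" and I: "semigroup_ideal (Omega_bar X Y) I"
  shows "J_set X Y (czero :: 's rel) (czero :: 't rel) \<subseteq> I"
proof
  fix h assume h: "h \<in> J_set X Y (czero :: 's rel) (czero :: 't rel)"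
  have left: "g \<otimes>\<^bsub>Omega_bar X Y\<^esub> f \<in> I" if "g \<in> carrier (Omega_bar X Y)" "f \<in> I" for g f
    using that I by (auto simp: semigroup_ideal_def set_mult_def)
  obtain f where f: "f \<in> I" "f \<in> carrier (Omega_bar X Y)"
    using I by (auto simp: semigroup_ideal_def)
  define p where "p = h \<otimes>\<^bsub>Omega_bar X Y\<^esub> f"
  have "p \<in> J_set X Y (czero :: 's rel) (czero :: 't rel)"
    unfolding p_def by (rule J_zero_mult_right[OF assms(1) h f(2)])
  then obtain g where "g \<in> carrier (Omega_bar X Y)" "h = g \<otimes>\<^bsub>Omega_bar X Y\<^esub> p"
    using J_zero_left_divisible[OF assms(1) _ h] by blast
  moreover have "p \<in> I"
    unfolding p_def using h f(1) by (intro left) (auto simp: mem_J_zero_iff)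
  ultimately show "h \<in> I"
    using left by simp
qed

theorem theorem5p8:
  fixes X Y :: "'a set"
  assumes "Y \<subseteq> X" and "infinite Y"
  shows "(\<exists>!I. minimal_ideal (Omega_bar X Y) I) \<and>
    semigroup_kernel (Omega_bar X Y) = J_set X Y (czero :: 's rel) (czero :: 't rel)"
  by (intro least_ideal_is_kernel J_zero_ideal[OF assms] J_zero_subset_ideal[OF assms(1)])

end
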